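(* Let $n$ be even, let $G=G_{n,1/2}$ and let $Z_n$ be the number of unordered partitions of $V(G)$ into two sets $\{A,B\}$ such that $G[A]$ and $G[B]$ both have all degrees odd. Then for $0\le k\le n-1$, $$\Pr(Z_n=2^k)=\frac{2^{n-k-1}-1}{2^{\binom n2}(2^{n-1}-1)}\prod_{i=1}^{\lfloor (n-1-k)/2\rfloor}(1-2^{-2i})^{-1}\prod_{i=k+1}^{n-1}(2^i-1),$$ and $\Pr(Z_n=x)=0$ if $x\neq0$ and $x\neq 2^k$ for every $0\le k\le n-1$.
   Context: $G_{n,1/2}$ is the binomial random graph on vertex set $[n]$ with each edge present independently with probability $1/2$. Empty products equal $1$. *)

theory Defs
  imports "HOL-Probability.Probability"
begin

text \<open>A simple graph is a pair of a vertex set and a set of edges, each edge being a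
  two-element set of vertices.\<close>

type_synonym 'a graph = "'a set \<times> 'a set set"

definition verts :: "'a graph \<Rightarrow> 'a set" where
  "verts G = fst G"

definition edges :: "'a graph \<Rightarrow> 'a set set" where
  "edges G = snd G"

definition degree :: "'a graph \<Rightarrow> 'a \<Rightarrow> nat" where
  "degree G v = card {e \<in> edges G. v \<in> e}"

definition induced :: "'a graph \<Rightarrow> 'a set \<Rightarrow> 'a graph" where
  "induced G A = (A, {e \<in> edges G. e \<subseteq> A})"

definition all_degrees_odd :: "'a graph \<Rightarrow> bool" where
  "all_degrees_odd G \<longleftrightarrow> (\<forall>v \<in> verts G. odd (degree G v))"

text \<open>A partition is the unordered pair \<open>{A, B}\<close>. One of the two sets may be empty:
  the graph without vertices has all degrees odd, so \<open>{V, {}}\<close> is counted when all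
  degrees of \<open>G\<close> itself are odd.\<close>

definition odd_partitions :: "'a graph \<Rightarrow> 'a set set set" where
  "odd_partitions G =
     {{A, B} | A B. A \<union> B = verts G \<and> A \<inter> B = {} \<and>
                    all_degrees_odd (induced G A) \<and> all_degrees_odd (induced G B)}"

definition num_odd_partitions :: "'a graph \<Rightarrow> nat" where
  "num_odd_partitions G = card (odd_partitions G)"

definition possible_edges :: "'a set \<Rightarrow> 'a set set" where
  "possible_edges V = {e. e \<subseteq> V \<and> card e = 2}"

definition binomial_random_graph :: "nat \<Rightarrow> real \<Rightarrow> nat graph pmf" where
  "binomial_random_graph n p =
     map_pmf (\<lambda>present. ({1..n}, {e \<in> possible_edges {1..n}. present e}))
       (Pi_pmf (possible_edges {1..n}) False (\<lambda>_. bernoulli_pmf p))"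

end

theory Submission
  imports Defs "HOL-Library.Z2" "HOL-Library.Function_Algebras"
begin

text \<open>
  Let \<open>A\<close> be the part of a partition not containing the vertex \<open>n\<close>, with indicator vector \<open>x\<close>.
  Modulo 2, all degrees inside both parts are odd iff \<open>M x = diag M + 1\<close>, where \<open>M\<close> is the
  Laplacian of the graph with row and column \<open>n\<close> deleted; the equation at the vertex \<open>n\<close> follows
  from the others because \<open>n\<close> is even. The graph can be recovered from \<open>M\<close>, so \<open>M\<close> is a uniformly
  random symmetric matrix of size \<open>n - 1\<close> over the field with two elements. The diagonal of a
  symmetric matrix always lies in its image, as \<open>x \<bullet> M x = diag M \<bullet> x\<close> in characteristic 2.
  Hence \<open>Z\<^sub>n\<close> is the size of the kernel of \<open>M\<close> if the all-ones vector lies in the image, and \<open>0\<close>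
  otherwise. A congruence of matrices replaces the all-ones vector by a unit vector \<open>e\<^sub>a\<close>. When a
  symmetric matrix is bordered by a new row and column \<open>a\<close>, the kernel shrinks, stays or grows
  according to whether the new column lies outside the image of the old matrix and, if it does
  not, whether the corner entry differs from the value that it determines; \<open>e\<^sub>a\<close> is in the image
  exactly in the first two cases. This gives recurrences that are solved by induction.
\<close>

section \<open>Vectors and matrices over the field with two elements\<close>

text \<open>The library's simplification rules would turn field arithmetic on \<open>bit\<close> into bit operations.\<close>

declare add_bit_eq_xor [simp del] mult_bit_eq_and [simp del]

lemma bit_add_self [simp]: "a + a = (0::bit)"
  by (cases a) simp_all

lemma bit_add_self_left [simp]: "a + (a + b) = (b::bit)"
  by (cases a; cases b) simp_all

lemma bit_add_eq_0_iff: "a + b = 0 \<longleftrightarrow> a = (b::bit)"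
  by (cases a; cases b) simp_all

lemma bit_fun_add_self [simp]: "x + x = (0::'a \<Rightarrow> bit)"
  by (simp add: fun_eq_iff)

lemma bit_fun_add_self_left [simp]: "x + (x + y) = (y::'a \<Rightarrow> bit)"
  by (simp add: fun_eq_iff)

lemma UNIV_bit: "UNIV = {0, 1::bit}"
  by (auto intro: bit.exhaust)

lemma finite_bit [simp]: "finite (A :: bit set)"
  by (rule finite_subset[of _ "{0,1}"]) (auto intro: bit.exhaust)

text \<open>The nontrivial additive character of the field. Integer values keep signs apart, which
  characteristic 2 cannot do.\<close>

definition chi :: "bit \<Rightarrow> int" where
  "chi b = (if b = 0 then 1 else - 1)"

lemma chi_add: "chi (a + b) = chi a * chi b"
  by (cases a; cases b) (simp_all add: chi_def)

text \<open>Translation by \<open>x0\<close> permutes \<open>S\<close> and flips the sign of every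
  term, so the sum is its own negative.\<close>

lemma sum_chi_eq_0:
  fixes h :: "('a \<Rightarrow> bit) \<Rightarrow> bit"
  assumes add: "\<And>x y. x \<in> S \<Longrightarrow> y \<in> S \<Longrightarrow> x + y \<in> S"
    and h: "\<And>x y. x \<in> S \<Longrightarrow> y \<in> S \<Longrightarrow> h (x + y) = h x + h y"
    and x0: "x0 \<in> S" "h x0 = 1"
  shows "(\<Sum>x\<in>S. chi (h x)) = 0"
proof -
  have "(\<Sum>x\<in>S. chi (h x)) = (\<Sum>x\<in>S. chi (h (x0 + x)))"
    by (rule sum.reindex_bij_witness[of _ "\<lambda>x. x0 + x" "\<lambda>x. x0 + x"]) (use add x0 in auto)
  also have "\<dots> = (\<Sum>x\<in>S. - chi (h x))"
    by (rule sum.cong) (use x0 in \<open>auto simp: h chi_add\<close>, auto simp: chi_def)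
  finally show ?thesis
    by (simp add: sum_negf)
qed

text \<open>Since \<open>chi\<close> is twice the indicator of 0 minus 1, the vanishing character
  sum says that \<open>h\<close> takes both values equally often.\<close>

lemma card_half:
  fixes h :: "('a \<Rightarrow> bit) \<Rightarrow> bit"
  assumes fin: "finite S"
    and add: "\<And>x y. x \<in> S \<Longrightarrow> y \<in> S \<Longrightarrow> x + y \<in> S"
    and h: "\<And>x y. x \<in> S \<Longrightarrow> y \<in> S \<Longrightarrow> h (x + y) = h x + h y"
    and x0: "x0 \<in> S" "h x0 = 1"
  shows "card S = 2 * card {x \<in> S. h x = 0}"
proof -
  have "0 = (\<Sum>x\<in>S. chi (h x))"
    using sum_chi_eq_0[of S h x0] assms by simp
  also have "\<dots> = (\<Sum>x\<in>S. 2 * of_bool (h x = 0) - 1)"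
    by (rule sum.cong) (auto simp: chi_def)
  also have "\<dots> = 2 * int (card {x \<in> S. h x = 0}) - int (card S)"
    using fin by (simp add: sum_subtractf sum_distrib_left[symmetric] of_bool_def sum.If_cases Int_def)
  finally show ?thesis
    by linarith
qed

text \<open>Vectors and matrices are indexed by a set \<open>I\<close> and vanish outside it, so that
  equality of functions is equality of vectors.\<close>

definition vecs :: "'a set \<Rightarrow> ('a \<Rightarrow> bit) set" where
  "vecs I = {x. \<forall>i. i \<notin> I \<longrightarrow> x i = 0}"

definition dot :: "'a set \<Rightarrow> ('a \<Rightarrow> bit) \<Rightarrow> ('a \<Rightarrow> bit) \<Rightarrow> bit" where
  "dot I x y = (\<Sum>i\<in>I. x i * y i)"

definition app :: "'a set \<Rightarrow> ('a \<Rightarrow> 'a \<Rightarrow> bit) \<Rightarrow> ('a \<Rightarrow> bit) \<Rightarrow> 'a \<Rightarrow> bit" where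
  "app I M x = (\<lambda>i. \<Sum>j\<in>I. M i j * x j)"

definition ker :: "'a set \<Rightarrow> ('a \<Rightarrow> 'a \<Rightarrow> bit) \<Rightarrow> ('a \<Rightarrow> bit) set" where
  "ker I M = {x \<in> vecs I. app I M x = 0}"

definition img :: "'a set \<Rightarrow> ('a \<Rightarrow> 'a \<Rightarrow> bit) \<Rightarrow> ('a \<Rightarrow> bit) set" where
  "img I M = app I M ` vecs I"

definition Sym :: "'a set \<Rightarrow> ('a \<Rightarrow> 'a \<Rightarrow> bit) set" where
  "Sym I = {M. (\<forall>i j. M i j = M j i) \<and> (\<forall>i j. i \<notin> I \<longrightarrow> M i j = 0)}"

lemma vecs_add: "x \<in> vecs I \<Longrightarrow> y \<in> vecs I \<Longrightarrow> x + y \<in> vecs I"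
  by (simp add: vecs_def)

lemma zero_in_vecs [simp]: "0 \<in> vecs I"
  by (simp add: vecs_def)

lemma vecs_empty [simp]: "vecs {} = {0}"
  by (auto simp: vecs_def)

lemma bij_betw_vecs_insert:
  assumes "a \<notin> I"
  shows "bij_betw (\<lambda>(x, t). x(a := t)) (vecs I \<times> UNIV) (vecs (insert a I))"
  by (rule bij_betw_byWitness[of _ "\<lambda>x. (x(a := 0), x a)"])
    (use assms in \<open>auto simp: vecs_def fun_eq_iff\<close>)

lemma finite_vecs [simp]: "finite I \<Longrightarrow> finite (vecs I)"
  and card_vecs: "finite I \<Longrightarrow> card (vecs I) = 2 ^ card I"
proof -
  have "finite (vecs I) \<and> card (vecs I) = 2 ^ card I" if "finite I"
    using that
  proof induction
    case (insert a I)
    then show ?case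
      using bij_betw_finite[OF bij_betw_vecs_insert[OF insert(2)]]
        bij_betw_same_card[OF bij_betw_vecs_insert[OF insert(2)]]
      by (simp add: card_cartesian_product UNIV_bit)
  qed auto
  then show "finite I \<Longrightarrow> finite (vecs I)" "finite I \<Longrightarrow> card (vecs I) = 2 ^ card I"
    by blast+
qed

lemma dot_add_left: "dot I (x + y) z = dot I x z + dot I y z"
  by (simp add: dot_def algebra_simps sum.distrib)

lemma dot_add_right: "dot I z (x + y) = dot I z x + dot I z y"
  by (simp add: dot_def algebra_simps sum.distrib)

lemma dot_0 [simp]: "dot I 0 x = 0" "dot I x 0 = 0"
  by (simp_all add: dot_def)

lemma app_add: "app I M (x + y) = app I M x + app I M y"
  by (simp add: app_def algebra_simps sum.distrib fun_eq_iff)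

lemma app_0 [simp]: "app I M 0 = 0"
  by (simp add: app_def fun_eq_iff)

lemma app_in_vecs: "M \<in> Sym I \<Longrightarrow> app I M x \<in> vecs I"
  by (simp add: app_def vecs_def Sym_def)

lemma dot_app: "M \<in> Sym I \<Longrightarrow> dot I (app I M x) y = dot I x (app I M y)"
  unfolding dot_def app_def sum_distrib_left sum_distrib_right
  by (subst sum.swap) (auto intro!: sum.cong simp: Sym_def ac_simps)

section \<open>Kernel, image and orthogonality\<close>

lemma ker_subset: "ker I M \<subseteq> vecs I"
  by (auto simp: ker_def)

lemma finite_ker [simp]: "finite I \<Longrightarrow> finite (ker I M)"
  by (rule finite_subset[OF ker_subset]) simp

lemma finite_img [simp]: "finite I \<Longrightarrow> finite (img I M)"
  by (simp add: img_def)

lemma img_subset: "M \<in> Sym I \<Longrightarrow> img I M \<subseteq> vecs I"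
  by (auto simp: img_def app_in_vecs)

lemma ker_add: "x \<in> ker I M \<Longrightarrow> y \<in> ker I M \<Longrightarrow> x + y \<in> ker I M"
  by (simp add: ker_def vecs_add app_add)

lemma zero_in_ker [simp]: "0 \<in> ker I M"
  by (simp add: ker_def)

text \<open>Double counting of \<open>(-1)\<^bsup>v \<bullet> x\<^esup>\<close> over all \<open>v\<close> and all \<open>x \<in> K\<close>.\<close>

lemma card_annihilator:
  assumes fin: "finite I" and K: "K \<subseteq> vecs I" "0 \<in> K"
    and add: "\<And>x y. x \<in> K \<Longrightarrow> y \<in> K \<Longrightarrow> x + y \<in> K"
  shows "card K * card {v \<in> vecs I. \<forall>x\<in>K. dot I v x = 0} = 2 ^ card I"
proof -
  let ?A = "{v \<in> vecs I. \<forall>x\<in>K. dot I v x = 0}"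
  have finK: "finite K"
    using K fin finite_subset finite_vecs by blast
  have inner: "(\<Sum>x\<in>K. chi (dot I v x)) = (if v \<in> ?A then int (card K) else 0)"
    if v: "v \<in> vecs I" for v
  proof (cases "v \<in> ?A")
    case True
    then show ?thesis by (simp add: chi_def)
  next
    case False
    then obtain x0 where "x0 \<in> K" "dot I v x0 = 1"
      using v by auto
    then show ?thesis
      using sum_chi_eq_0[of K "dot I v" x0] add False by (simp only: dot_add_right) simp
  qed
  have outer: "(\<Sum>v\<in>vecs I. chi (dot I v x)) = (if x = 0 then 2 ^ card I else 0)"
    if x: "x \<in> K" for x
  proof (cases "x = 0")
    case True
    then show ?thesis by (simp add: chi_def card_vecs fin)
  next
    case False
    then obtain i where i: "x i = 1"
      by (auto simp: fun_eq_iff)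
    have "i \<in> I"
      using i x K(1) by (force simp: vecs_def)
    then have "(\<lambda>j. if j = i then 1 else 0) \<in> vecs I" "dot I (\<lambda>j. if j = i then 1 else 0) x = 1"
      using fin i by (auto simp: vecs_def dot_def if_distribR if_distrib[of "\<lambda>u. u * _"] cong: if_cong)
    then show ?thesis
      using sum_chi_eq_0[of "vecs I" "\<lambda>v. dot I v x"] False
      by (simp only: vecs_add dot_add_left) simp
  qed
  have "int (card K * card ?A) = (\<Sum>v\<in>vecs I. \<Sum>x\<in>K. chi (dot I v x))"
    using fin by (simp add: inner sum.If_cases Int_def)
  also have "\<dots> = (\<Sum>x\<in>K. \<Sum>v\<in>vecs I. chi (dot I v x))"
    by (rule sum.swap)
  also have "\<dots> = int (2 ^ card I)"
    using K finK by (simp add: outer)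
  finally show ?thesis
    by (simp only: of_nat_eq_iff)
qed

lemma card_fiber:
  assumes "b \<in> img I M"
  shows "card {x \<in> vecs I. app I M x = b} = card (ker I M)"
proof -
  obtain y where y: "y \<in> vecs I" "app I M y = b"
    using assms by (auto simp: img_def)
  have "bij_betw (\<lambda>x. y + x) (ker I M) {x \<in> vecs I. app I M x = b}"
    by (rule bij_betw_byWitness[of _ "\<lambda>x. y + x"]) (use y in \<open>auto simp: ker_def vecs_add app_add\<close>)
  then show ?thesis
    by (metis bij_betw_same_card)
qed

text \<open>Rank-nullity in multiplicative form: all nonempty fibers of \<open>app I M\<close> are
  translates of the kernel.\<close>

lemma card_img_ker:
  assumes "finite I"
  shows "card (ker I M) * card (img I M) = 2 ^ card I"
proof -
  have "card (vecs I) = (\<Sum>b\<in>img I M. card {x \<in> vecs I. app I M x = b})"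
    using sum.group[of "vecs I" "img I M" "app I M" "\<lambda>_. 1 :: nat"] assms
    by (simp add: img_def)
  then show ?thesis
    using assms by (simp add: card_fiber card_vecs)
qed

text \<open>Symmetry of \<open>M\<close> puts the image inside the annihilator of the kernel. Both
  have size \<open>2 ^ card I\<close> divided by the size of the kernel, so they coincide. This is
  the solvability criterion used from here on.\<close>

lemma img_eq_annihilator:
  assumes fin: "finite I" and M: "M \<in> Sym I"
  shows "img I M = {v \<in> vecs I. \<forall>x\<in>ker I M. dot I v x = 0}"
proof (rule card_subset_eq)
  show "finite {v \<in> vecs I. \<forall>x\<in>ker I M. dot I v x = 0}"
    using fin by simp
  show "img I M \<subseteq> {v \<in> vecs I. \<forall>x\<in>ker I M. dot I v x = 0}"
    by (auto simp: img_def app_in_vecs dot_app M ker_def)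
  have "card (ker I M) * card {v \<in> vecs I. \<forall>x\<in>ker I M. dot I v x = 0} = 2 ^ card I"
    by (rule card_annihilator) (use fin ker_subset in \<open>auto intro: ker_add\<close>)
  then have "card (ker I M) * card {v \<in> vecs I. \<forall>x\<in>ker I M. dot I v x = 0} = card (ker I M) * card (img I M)"
    using card_img_ker[OF fin, of M] by simp
  moreover have "card (ker I M) > 0"
    using fin zero_in_ker by (metis card_gt_0_iff empty_iff finite_ker)
  ultimately show "card (img I M) = card {v \<in> vecs I. \<forall>x\<in>ker I M. dot I v x = 0}"
    by simp
qed

lemma card_ker_power2:
  assumes "finite I"
  shows "\<exists>k\<le>card I. card (ker I M) = 2 ^ k"
proof -
  have "card (ker I M) dvd 2 ^ card I"
    by (metis assms card_img_ker dvd_triv_left)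
  then show ?thesis
    by (simp add: divides_primepow_nat)
qed

text \<open>Off-diagonal terms cancel in pairs, and squares of bits are the bits themselves. Plain
  symmetry is assumed instead of \<open>M \<in> Sym I\<close> so that the induction on
  \<open>I\<close> can keep \<open>M\<close> fixed.\<close>

lemma dot_app_self:
  assumes fin: "finite I" and sym: "\<And>i j. M i j = M j i"
  shows "dot I x (app I M x) = (\<Sum>i\<in>I. M i i * x i)"
  using fin
proof induction
  case empty
  then show ?case by (simp add: dot_def)
next
  case (insert a I)
  have "dot (insert a I) x (app (insert a I) M x) =
      x a * (M a a * x a + (\<Sum>j\<in>I. M a j * x j)) + (\<Sum>i\<in>I. x i * (M i a * x a)) + dot I x (app I M x)"
    using insert by (simp add: dot_def app_def algebra_simps sum.distrib)
  also have "(\<Sum>i\<in>I. x i * (M i a * x a)) = x a * (\<Sum>j\<in>I. M a j * x j)"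
    by (simp add: sum_distrib_left sym[of _ a] ac_simps)
  also have "x a * (M a a * x a + (\<Sum>j\<in>I. M a j * x j)) = M a a * x a + x a * (\<Sum>j\<in>I. M a j * x j)"
    by (cases "x a") auto
  finally show ?case
    using insert by (simp add: add.assoc)
qed

lemma diag_in_img:
  assumes fin: "finite I" and M: "M \<in> Sym I"
  shows "(\<lambda>i. M i i) \<in> img I M"
proof -
  have "dot I (\<lambda>i. M i i) x = 0" if "x \<in> ker I M" for x
    using dot_app_self[of I M x] that fin M by (simp add: ker_def Sym_def dot_def)
  moreover have "(\<lambda>i. M i i) \<in> vecs I"
    using M by (simp add: vecs_def Sym_def)
  ultimately show ?thesis
    by (simp add: img_eq_annihilator fin M)
qed

lemma img_add: "x \<in> img I M \<Longrightarrow> y \<in> img I M \<Longrightarrow> x + y \<in> img I M"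
  by (auto simp: img_def app_add[symmetric] intro!: imageI vecs_add)

text \<open>The diagonal lies in the image, so adding it to \<open>w\<close> does not affect
  solvability.\<close>

lemma card_solutions_diag_add:
  assumes fin: "finite I" and M: "M \<in> Sym I"
  shows "card {x \<in> vecs I. app I M x = (\<lambda>i. M i i) + w} = (if w \<in> img I M then card (ker I M) else 0)"
proof -
  have eq: "(\<lambda>i. M i i) + w \<in> img I M \<longleftrightarrow> w \<in> img I M"
    using img_add[of "\<lambda>i. M i i" I M w] img_add[of "\<lambda>i. M i i" I M "(\<lambda>i. M i i) + w"]
      diag_in_img[OF fin M] by auto
  show ?thesis
  proof (cases "w \<in> img I M")
    case True
    then show ?thesis
      using eq by (simp add: card_fiber)
  next
    case False
    then have "{x \<in> vecs I. app I M x = (\<lambda>i. M i i) + w} = {}"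
      using eq by (force simp: img_def)
    then show ?thesis
      using False by (metis card.empty)
  qed
qed

section \<open>Symmetric matrices with a given kernel size\<close>

definition border :: "'a \<Rightarrow> ('a \<Rightarrow> 'a \<Rightarrow> bit) \<Rightarrow> ('a \<Rightarrow> bit) \<Rightarrow> bit \<Rightarrow> 'a \<Rightarrow> 'a \<Rightarrow> bit" where
  "border a M v c = (\<lambda>i j. if i = a then if j = a then c else v j else if j = a then v i else M i j)"

lemma bij_betw_border:
  assumes "a \<notin> I"
  shows "bij_betw (\<lambda>(M, v, c). border a M v c) (Sym I \<times> vecs I \<times> UNIV) (Sym (insert a I))"
  by (rule bij_betw_byWitness[of _ "\<lambda>M. (\<lambda>i j. if i = a \<or> j = a then 0 else M i j, \<lambda>i. if i = a then 0 else M a i, M a a)"])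
    (use assms in \<open>auto simp: Sym_def vecs_def border_def fun_eq_iff\<close>)

lemma Sym_outside: "M \<in> Sym I \<Longrightarrow> i \<notin> I \<or> j \<notin> I \<Longrightarrow> M i j = 0"
  unfolding Sym_def by (metis (mono_tags, lifting) mem_Collect_eq)

lemma Sym_empty [simp]: "Sym {} = {0}"
  by (auto simp: Sym_def fun_eq_iff)

lemma finite_Sym [simp]: "finite I \<Longrightarrow> finite (Sym I)"
proof (induction rule: finite_induct)
  case (insert a I)
  then show ?case
    using bij_betw_finite[OF bij_betw_border[OF insert(2)]] by simp
qed simp

lemma card_Sym: "finite I \<Longrightarrow> card (Sym I) = 2 ^ (Suc (card I) choose 2)"
proof (induction rule: finite_induct)
  case (insert a I)
  then show ?case
    using bij_betw_same_card[OF bij_betw_border[OF insert(2)]]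
      insert(1,3) choose_reduce_nat[of "Suc (Suc (card I))" 2]
    by (simp add: card_cartesian_product card_vecs UNIV_bit insert(2) power_add algebra_simps)
qed (simp add: binomial_eq_0)

lemma app_border:
  assumes "finite I" "a \<notin> I" "M \<in> Sym I" "v \<in> vecs I"
  shows "app (insert a I) (border a M v c) (x(a := t)) =
    (\<lambda>i. if i = a then dot I v x + c * t else app I M x i + v i * t)"
proof -
  have ne: "\<And>j. j \<in> I \<Longrightarrow> j \<noteq> a"
    using assms by auto
  show ?thesis
    using assms by (auto simp: app_def dot_def border_def fun_eq_iff ne add.commute intro!: sum.cong)
qed

lemma mem_ker_border_iff:
  assumes "finite I" "a \<notin> I" "M \<in> Sym I" "v \<in> vecs I" "x \<in> vecs I"
  shows "x(a := t) \<in> ker (insert a I) (border a M v c) \<longleftrightarrow>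
    app I M x = (\<lambda>i. v i * t) \<and> dot I v x = c * t"
proof -
  \<comment> \<open>Both sides of the first block equation vanish at \<open>a\<close>, so it can be
    stated as an equality of functions, and coordinate \<open>a\<close> carries only the second
    equation.\<close>
  have "app I M x a = 0" "v a = 0"
    using assms app_in_vecs[of M I x] by (auto simp: vecs_def)
  moreover have "x(a := t) \<in> vecs (insert a I)"
    using assms by (simp add: vecs_def)
  then have "x(a := t) \<in> ker (insert a I) (border a M v c) \<longleftrightarrow>
      (\<forall>i. (if i = a then dot I v x + c * t else app I M x i + v i * t) = 0)"
    by (simp only: ker_def mem_Collect_eq app_border[OF assms(1-4)] fun_eq_iff zero_fun_apply simp_thms)
  ultimately show ?thesis
    by (metis (no_types, lifting) add_0 bit_add_eq_0_iff ext mult_zero_left)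
qed

text \<open>Split by the coordinate at \<open>a\<close>: the value 0 leaves kernel vectors of
  \<open>M\<close> orthogonal to \<open>v\<close>, the value 1 leaves solutions of
  \<open>M x = v\<close> that also satisfy the new row.\<close>

lemma ker_border:
  assumes "finite I" "a \<notin> I" "M \<in> Sym I" "v \<in> vecs I"
  shows "ker (insert a I) (border a M v c) =
    {x \<in> ker I M. dot I v x = 0} \<union> (\<lambda>x. x(a := 1)) ` {x \<in> vecs I. app I M x = v \<and> dot I v x = c}"
    (is "?L = ?A \<union> ?B")
proof (intro equalityI subsetI)
  fix z assume z: "z \<in> ?L"
  then have "z(a := 0) \<in> vecs I"
    by (auto simp: ker_def vecs_def)
  note iff = mem_ker_border_iff[OF assms this, of "z a" c]
  show "z \<in> ?A \<union> ?B"
  proof (cases "z a = 0")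
    case True
    then have "z(a := 0) = z"
      by auto
    then show ?thesis
      using True iff z \<open>z(a := 0) \<in> vecs I\<close> by (simp add: ker_def zero_fun_def)
  next
    case False
    then have "z = (z(a := 0))(a := 1)"
      by auto
    then show ?thesis
      using False iff z \<open>z(a := 0) \<in> vecs I\<close> by (intro UnI2 image_eqI) auto
  qed
next
  fix z assume "z \<in> ?A \<union> ?B"
  then show "z \<in> ?L"
  proof
    assume z: "z \<in> ?A"
    then have "z(a := 0) = z"
      using assms by (auto simp: ker_def vecs_def)
    then show ?thesis
      using z mem_ker_border_iff[OF assms, of z 0 c] by (simp add: ker_def zero_fun_def)
  next
    assume "z \<in> ?B"
    then show ?thesis
      using mem_ker_border_iff[OF assms, of _ 1 c] by auto
  qed
qed

text \<open>The condition that all \<open>z\<close> in the kernel have \<open>z a = 0\<close> says that the unit vector at \<open>a\<close>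
  is orthogonal to the kernel, that is, that it lies in the image.\<close>

lemma ker_border_cases:
  fixes c :: bit
  assumes "finite I" "a \<notin> I" "M \<in> Sym I" "v \<in> vecs I"
    and K_def: "K = ker (insert a I) (border a M v c)"
  shows "v \<notin> img I M \<Longrightarrow> card K = card (ker I M) div 2 \<and> (\<forall>z\<in>K. z a = 0)"
    and "v = app I M y \<Longrightarrow> y \<in> vecs I \<Longrightarrow> c \<noteq> dot I v y \<Longrightarrow> card K = card (ker I M) \<and> (\<forall>z\<in>K. z a = 0)"
    and "v = app I M y \<Longrightarrow> y \<in> vecs I \<Longrightarrow> c = dot I v y \<Longrightarrow> card K = 2 * card (ker I M) \<and> \<not> (\<forall>z\<in>K. z a = 0)"
proof -
  have a0: "z a = 0" if "z \<in> vecs I" for z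
    using that assms by (simp add: vecs_def)
  note K = ker_border[OF assms(1-4), of c, folded K_def]
  {
    assume "v \<notin> img I M"
    then obtain x where x: "x \<in> ker I M" "dot I v x = 1"
      using assms by (auto simp: img_eq_annihilator)
    have "card (ker I M) = 2 * card {x \<in> ker I M. dot I v x = 0}"
      by (rule card_half[of _ "dot I v" x]) (use assms x in \<open>auto simp: ker_add dot_add_right\<close>)
    moreover have "K = {x \<in> ker I M. dot I v x = 0}"
      using \<open>v \<notin> img I M\<close> by (auto simp: K img_def)
    ultimately show "card K = card (ker I M) div 2 \<and> (\<forall>z\<in>K. z a = 0)"
      by (auto simp: ker_def a0)
  }
  assume y: "v = app I M y" "y \<in> vecs I"
  have dot_ker: "dot I v x = 0" if "x \<in> ker I M" for x
    using that by (simp add: y dot_app assms(3) ker_def)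
  then have ker: "{x \<in> ker I M. dot I v x = 0} = ker I M"
    by auto
  \<comment> \<open>Two solutions differ by a kernel vector, to which \<open>v\<close> is
    orthogonal. Hence \<open>v\<close> alone determines the one corner entry for which the kernel
    grows.\<close>
  have dot_sol: "dot I v x = dot I v y" if "x \<in> vecs I" "app I M x = v" for x
    using dot_ker[of "x + y"] that y by (simp add: ker_def vecs_add app_add dot_add_right bit_add_eq_0_iff)
  {
    assume "c \<noteq> dot I v y"
    then have "{x \<in> vecs I. app I M x = v \<and> dot I v x = c} = {}"
      using dot_sol by auto
    then have "K = ker I M"
      unfolding K ker by (metis image_empty sup_bot.right_neutral)
    then show "card K = card (ker I M) \<and> (\<forall>z\<in>K. z a = 0)"
      by (auto simp: ker_def a0)
  }
  assume "c = dot I v y"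
  then have K': "K = ker I M \<union> (\<lambda>x. x(a := 1)) ` {x \<in> vecs I. app I M x = v}"
    unfolding K ker using dot_sol by auto
  have "inj_on (\<lambda>x. x(a := 1)) {x \<in> vecs I. app I M x = v}"
    by (rule inj_on_inverseI[where g = "\<lambda>x. x(a := 0)"]) (auto simp: fun_eq_iff a0)
  then have "card ((\<lambda>x. x(a := 1)) ` {x \<in> vecs I. app I M x = v}) = card (ker I M)"
    using y by (simp add: card_image card_fiber img_def)
  moreover have "ker I M \<inter> (\<lambda>x. x(a := 1)) ` {x \<in> vecs I. app I M x = v} = {}"
    by (auto simp: ker_def a0 dest!: a0)
  ultimately have "card K = 2 * card (ker I M)"
    unfolding K' using assms by (subst card_Un_disjoint) auto
  moreover have "y(a := 1) \<in> K"
    using y by (auto simp: K')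
  ultimately show "card K = 2 * card (ker I M) \<and> \<not> (\<forall>z\<in>K. z a = 0)"
    by force
qed

text \<open>The weight \<open>f\<close> is arbitrary so that one summation yields every recurrence
  below. A column outside the image gives the same outcome for both corner entries; a column inside
  gives one outcome for each of them.\<close>

lemma sum_Sym_insert:
  fixes f :: "nat \<Rightarrow> bool \<Rightarrow> real"
  assumes fin: "finite I" "a \<notin> I"
  shows "(\<Sum>M\<in>Sym (insert a I). f (card (ker (insert a I) M)) (\<forall>z\<in>ker (insert a I) M. z a = 0)) =
    (\<Sum>M\<in>Sym I. 2 * (2 ^ card I - real (card (img I M))) * f (card (ker I M) div 2) True
       + card (img I M) * (f (card (ker I M)) True + f (2 * card (ker I M)) False))"
proof -
  let ?g = "\<lambda>M. f (card (ker (insert a I) M)) (\<forall>z\<in>ker (insert a I) M. z a = 0)"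
  have "(\<Sum>M\<in>Sym (insert a I). ?g M) = (\<Sum>(M, v, c)\<in>Sym I \<times> vecs I \<times> UNIV. ?g (border a M v c))"
    using sum.reindex_bij_betw[OF bij_betw_border[OF fin(2)], of ?g, symmetric]
    by (simp add: case_prod_unfold)
  also have "\<dots> = (\<Sum>M\<in>Sym I. \<Sum>v\<in>vecs I. \<Sum>c\<in>UNIV. ?g (border a M v c))"
    by (simp add: sum.cartesian_product)
  also have "\<dots> = (\<Sum>M\<in>Sym I. 2 * (2 ^ card I - real (card (img I M))) * f (card (ker I M) div 2) True
       + card (img I M) * (f (card (ker I M)) True + f (2 * card (ker I M)) False))"
  proof (rule sum.cong[OF refl])
    fix M assume M: "M \<in> Sym I"
    note C = ker_border_cases[OF fin M _ refl]
    have out: "(\<Sum>c\<in>UNIV. ?g (border a M v c)) = 2 * f (card (ker I M) div 2) True"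
      if "v \<in> vecs I - img I M" for v
      using C(1)[of v] that by (simp add: UNIV_bit)
    have "in": "(\<Sum>c\<in>UNIV. ?g (border a M v c)) = f (card (ker I M)) True + f (2 * card (ker I M)) False"
      if v_img: "v \<in> img I M" for v
    proof -
      obtain y where y: "v = app I M y" "y \<in> vecs I"
        using v_img by (auto simp: img_def)
      have v: "v \<in> vecs I"
        using y M by (simp add: app_in_vecs)
      \<comment> \<open>The two corner entries are listed relative to the exceptional value
        \<open>dot I v y\<close>, whichever bit that is.\<close>
      have "(\<Sum>c\<in>UNIV. ?g (border a M v c)) =
          ?g (border a M v (dot I v y + 1)) + ?g (border a M v (dot I v y))"
        by (cases "dot I v y") (simp_all add: UNIV_bit)
      moreover have "dot I v y + 1 \<noteq> dot I v y"
        by (cases "dot I v y") simp_all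
      ultimately show ?thesis
        using C(2)[OF v y, of "dot I v y + 1"] C(3)[OF v y, of "dot I v y"] by simp
    qed
    have "(\<Sum>v\<in>vecs I. \<Sum>c\<in>UNIV. ?g (border a M v c)) =
        (\<Sum>v\<in>vecs I - img I M. \<Sum>c\<in>UNIV. ?g (border a M v c)) + (\<Sum>v\<in>img I M. \<Sum>c\<in>UNIV. ?g (border a M v c))"
      by (rule sum.subset_diff) (use fin M in \<open>auto simp: img_subset\<close>)
    also have "\<dots> = real (card (vecs I - img I M)) * (2 * f (card (ker I M) div 2) True)
        + card (img I M) * (f (card (ker I M)) True + f (2 * card (ker I M)) False)"
      by (simp add: out "in")
    also have "real (card (vecs I - img I M)) = 2 ^ card I - real (card (img I M))"
      using fin M card_mono[OF _ img_subset[OF M]]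
      by (simp add: card_Diff_subset img_subset card_vecs of_nat_diff)
    finally show "(\<Sum>v\<in>vecs I. \<Sum>c\<in>UNIV. ?g (border a M v c)) =
       2 * (2 ^ card I - real (card (img I M))) * f (card (ker I M) div 2) True
       + card (img I M) * (f (card (ker I M)) True + f (2 * card (ker I M)) False)"
      by simp
  qed
  finally show ?thesis .
qed

section \<open>Recurrences for the counts by kernel size\<close>

definition num_ker :: "'a set \<Rightarrow> nat \<Rightarrow> real" where
  "num_ker I k = real (card {M \<in> Sym I. card (ker I M) = 2 ^ k})"

lemma sum_of_bool_eq_card:
  "finite A \<Longrightarrow> (\<Sum>x\<in>A. of_bool (P x)) = real (card {x \<in> A. P x})"
  by (simp add: of_bool_def sum.If_cases Int_def)

lemma card_img: "finite I \<Longrightarrow> card (ker I M) = 2 ^ k \<Longrightarrow> real (card (img I M)) = 2 ^ card I / 2 ^ k"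
  using arg_cong[OF card_img_ker[of I M], of real] by (simp add: field_simps)

text \<open>Kernel size \<open>2 ^ k\<close> with the pivot condition arises by halving
  \<open>2 ^ Suc k\<close> or by keeping \<open>2 ^ k\<close>. The coefficients count the borders
  that do this.\<close>

lemma num_pivot_recurrence:
  assumes fin: "finite I" "a \<notin> I"
  shows "real (card {M \<in> Sym (insert a I). card (ker (insert a I) M) = 2 ^ k \<and> (\<forall>z\<in>ker (insert a I) M. z a = 0)}) =
     2 * (2 ^ card I - 2 ^ card I / 2 ^ Suc k) * num_ker I (Suc k) + 2 ^ card I / 2 ^ k * num_ker I k"
proof -
  \<comment> \<open>The truncating division is harmless: the kernel size is a power of 2, and size 1
    gives 0.\<close>
  have half: "card (ker I M) div 2 = 2 ^ k \<longleftrightarrow> card (ker I M) = 2 ^ Suc k" for M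
  proof -
    obtain j where "card (ker I M) = 2 ^ j"
      using card_ker_power2[OF fin(1)] by blast
    then show ?thesis by (cases j) auto
  qed
  have "real (card {M \<in> Sym (insert a I). card (ker (insert a I) M) = 2 ^ k \<and> (\<forall>z\<in>ker (insert a I) M. z a = 0)}) =
     (\<Sum>M\<in>Sym (insert a I). of_bool (card (ker (insert a I) M) = 2 ^ k \<and> (\<forall>z\<in>ker (insert a I) M. z a = 0)))"
    using fin by (intro sum_of_bool_eq_card[symmetric]) simp
  also have "\<dots> = (\<Sum>M\<in>Sym I. 2 * (2 ^ card I - real (card (img I M))) * of_bool (card (ker I M) = 2 ^ Suc k)
       + card (img I M) * of_bool (card (ker I M) = 2 ^ k))"
    using sum_Sym_insert[OF fin, of "\<lambda>c b. of_bool (c = 2 ^ k \<and> b)"] by (simp add: half del: power_Suc)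
  also have "\<dots> = (\<Sum>M\<in>Sym I. 2 * (2 ^ card I - 2 ^ card I / 2 ^ Suc k) * of_bool (card (ker I M) = 2 ^ Suc k)
       + 2 ^ card I / 2 ^ k * of_bool (card (ker I M) = 2 ^ k))"
    by (rule sum.cong) (use card_img[OF fin(1)] in \<open>auto simp del: power_Suc\<close>)
  finally show ?thesis
    using fin by (simp only: sum.distrib sum_distrib_left[symmetric] sum_of_bool_eq_card finite_Sym num_ker_def)
qed

text \<open>The extra term comes from kernels that grow from \<open>2 ^ (k - 1)\<close>; it is
  absent for \<open>k = 0\<close>, since a doubled kernel is never trivial.\<close>

lemma num_ker_recurrence:
  assumes fin: "finite I" "a \<notin> I"
  shows "num_ker (insert a I) k =
     2 * (2 ^ card I - 2 ^ card I / 2 ^ Suc k) * num_ker I (Suc k) + 2 ^ card I / 2 ^ k * num_ker I k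
     + (if k = 0 then 0 else 2 * 2 ^ card I / 2 ^ k * num_ker I (k - 1))"
proof -
  let ?P = "\<lambda>M. \<forall>z\<in>ker (insert a I) M. z a = 0"
  have "num_ker (insert a I) k = real (card {M \<in> Sym (insert a I). card (ker (insert a I) M) = 2 ^ k \<and> ?P M})
      + real (card {M \<in> Sym (insert a I). card (ker (insert a I) M) = 2 ^ k \<and> \<not> ?P M})"
    unfolding num_ker_def using fin
    by (subst of_nat_add[symmetric], subst card_Un_disjoint[symmetric]) (auto intro!: arg_cong[of _ _ card])
  moreover have "real (card {M \<in> Sym (insert a I). card (ker (insert a I) M) = 2 ^ k \<and> \<not> ?P M}) =
      (if k = 0 then 0 else 2 * 2 ^ card I / 2 ^ k * num_ker I (k - 1))"
  proof -
    have "real (card {M \<in> Sym (insert a I). card (ker (insert a I) M) = 2 ^ k \<and> \<not> ?P M}) =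
       (\<Sum>M\<in>Sym (insert a I). of_bool (card (ker (insert a I) M) = 2 ^ k \<and> \<not> ?P M))"
      using fin by (intro sum_of_bool_eq_card[symmetric]) simp
    also have "\<dots> = (\<Sum>M\<in>Sym I. real (card (img I M)) * of_bool (2 * card (ker I M) = 2 ^ k))"
      using sum_Sym_insert[OF fin, of "\<lambda>c b. of_bool (c = 2 ^ k \<and> \<not> b)"] by simp
    also have "\<dots> = (\<Sum>M\<in>Sym I. (if k = 0 then 0 else 2 * 2 ^ card I / 2 ^ k * of_bool (card (ker I M) = 2 ^ (k - 1))))"
    proof (rule sum.cong[OF refl])
      fix M
      show "real (card (img I M)) * of_bool (2 * card (ker I M) = 2 ^ k) =
        (if k = 0 then 0 else 2 * 2 ^ card I / 2 ^ k * of_bool (card (ker I M) = 2 ^ (k - 1)))"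
        using card_img[OF fin(1), of M "k - 1"] by (cases k) auto
    qed
    finally show ?thesis
      using fin by (cases "k = 0")
        (simp_all only: if_True if_False simp_thms sum_distrib_left[symmetric] sum_of_bool_eq_card finite_Sym num_ker_def sum.neutral_const)
  qed
  ultimately show ?thesis
    by (simp only: num_pivot_recurrence[OF fin])
qed

section \<open>Solving the recurrences\<close>

definition even_prod :: "nat \<Rightarrow> real" where
  "even_prod d = (\<Prod>i = 1..d div 2. inverse (1 - 1 / 2 ^ (2 * i)))"

text \<open>MacWilliams' count of symmetric matrices of size \<open>m\<close> and nullity
  \<open>k\<close> over the field with two elements.\<close>

definition num_formula :: "nat \<Rightarrow> nat \<Rightarrow> real" where
  "num_formula m k = even_prod (m - k) * (\<Prod>i = k + 1..m. 2 ^ i - 1)"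

text \<open>\<open>even_prod\<close> depends only on \<open>d div 2\<close>. For even positive
  \<open>d\<close>, passing to \<open>d - 1\<close> drops one factor; for odd \<open>d\<close>,
  passing to \<open>Suc d\<close> adds one. Either way the sum on the left telescopes to a single
  multiple of \<open>even_prod (Suc d)\<close>.\<close>

lemma even_prod_recurrence:
  "2 ^ d * ((if d = 0 then 0 else even_prod (d - 1)) + even_prod d) = even_prod (Suc d) * (2 ^ Suc d - 1)"
proof -
  have step: "even_prod (2 * s + 1) = even_prod (2 * s)"
    "even_prod (2 * Suc s) * (1 - 1 / 2 ^ (2 * Suc s)) = even_prod (2 * s)" for s
  proof -
    have "(1::real) < 2 ^ (2 * Suc s)"
      by (rule one_less_power) auto
    then show "even_prod (2 * Suc s) * (1 - 1 / 2 ^ (2 * Suc s)) = even_prod (2 * s)"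
      by (simp add: even_prod_def field_simps)
  qed (simp add: even_prod_def)
  show ?thesis
  proof (cases "even d")
    case True
    show ?thesis
    proof (cases "d = 0")
      case True
      then show ?thesis by (simp add: even_prod_def)
    next
      case False
      then obtain s where d: "d = 2 * Suc s"
        using True by (metis dvd_def mult_0_right not0_implies_Suc)
      have "even_prod (d - 1) = even_prod d * (1 - 1 / 2 ^ d)" "even_prod (Suc d) = even_prod d"
        using step(1)[of s] step(2)[of s] step(1)[of "Suc s"] by (simp_all add: d)
      then show ?thesis
        using False by (simp add: field_simps)
    qed
  next
    case False
    then obtain s where d: "d = 2 * s + 1"
      by (metis oddE)
    have "even_prod (d - 1) = even_prod (Suc d) * (1 - 1 / 2 ^ Suc d)" "even_prod d = even_prod (Suc d) * (1 - 1 / 2 ^ Suc d)"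
      using step(1)[of s] step(2)[of s] by (simp_all add: d)
    then show ?thesis
      using d by (simp add: field_simps)
  qed
qed

text \<open>The right-hand side of \<open>num_pivot_recurrence\<close> with the closed form
  inserted. The resulting fraction is the chance that a random subspace of dimension
  \<open>Suc m - k\<close> contains a given nonzero vector. After cancelling the common product,
  \<open>even_prod_recurrence\<close> at \<open>d = m - k\<close> remains.\<close>

lemma num_formula_pivot:
  assumes "k \<le> Suc m"
  shows "2 * (2 ^ m - 2 ^ m / 2 ^ Suc k) * (if Suc k \<le> m then num_formula m (Suc k) else 0)
      + 2 ^ m / 2 ^ k * (if k \<le> m then num_formula m k else 0)
    = num_formula (Suc m) k * ((2 ^ (Suc m - k) - 1) / (2 ^ Suc m - 1))"
proof (cases "k = Suc m")
  case False
  define d where "d = m - k"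
  have m: "m = k + d"
    using assms False by (simp add: d_def)
  define Q :: real where "Q = (\<Prod>i = k + 1..m. 2 ^ i - 1)"
  have "2 * (2 ^ m - 2 ^ m / 2 ^ Suc k) * (if Suc k \<le> m then num_formula m (Suc k) else 0)
      = 2 ^ d * Q * (if d = 0 then 0 else even_prod (d - 1))"
  proof (cases "d = 0")
    case False
    then have "Q = (2 ^ Suc k - 1) * (\<Prod>i = Suc k + 1..m. 2 ^ i - 1)"
      unfolding Q_def m by (subst prod.atLeast_Suc_atMost) auto
    moreover have "2 * (2 ^ m - 2 ^ m / 2 ^ Suc k) = (2 ^ d * (2 ^ Suc k - 1) :: real)"
      by (simp add: m field_simps power_add)
    ultimately show ?thesis
      using False by (simp add: num_formula_def m)
  qed (simp add: m)
  moreover have "2 ^ m / 2 ^ k * (if k \<le> m then num_formula m k else 0) = 2 ^ d * Q * even_prod d"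
    by (simp add: num_formula_def Q_def m power_add)
  moreover have "num_formula (Suc m) k = even_prod (Suc d) * Q * (2 ^ Suc m - 1)"
    by (simp add: num_formula_def Q_def m)
  moreover have "2 ^ Suc m - (1::real) \<noteq> 0"
    using one_less_power[of "2::real" "Suc m"] by simp
  moreover have "2 ^ d * Q * (if d = 0 then 0 else even_prod (d - 1)) + 2 ^ d * Q * even_prod d =
      Q * (even_prod (Suc d) * (2 ^ Suc d - 1))"
    unfolding even_prod_recurrence[symmetric] by (simp only: algebra_simps)
  moreover have "Suc m - k = Suc d"
    by (simp add: m)
  ultimately show ?thesis
    by simp
qed simp

text \<open>The complementary share, from growing kernels. Size minus nullity is the same on both
  sides, so the \<open>even_prod\<close> factors agree and only the other products differ.\<close>

lemma num_formula_nonpivot: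
  assumes "k \<le> Suc m"
  shows "(if k = 0 then 0 else 2 * 2 ^ m / 2 ^ k * num_formula m (k - 1))
    = num_formula (Suc m) k * ((2 ^ Suc m - 2 ^ (Suc m - k)) / (2 ^ Suc m - 1))"
proof (cases k)
  case (Suc j)
  define d where "d = m - j"
  have m: "m = j + d"
    using assms Suc by (simp add: d_def)
  \<comment> \<open>Peeling the same product at its bottom and at its top relates the two products
    to be compared.\<close>
  have "(\<Prod>i = j + 1..Suc m. 2 ^ i - 1 :: real) = (2 ^ k - 1) * (\<Prod>i = k + 1..Suc m. 2 ^ i - 1)"
    unfolding m Suc by (subst prod.atLeast_Suc_atMost) auto
  moreover have "(\<Prod>i = j + 1..Suc m. 2 ^ i - 1 :: real) = (\<Prod>i = j + 1..m. 2 ^ i - 1) * (2 ^ Suc m - 1)"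
    by (simp add: m)
  moreover have pos: "2 ^ Suc m - (1::real) \<noteq> 0"
    using one_less_power[of "2::real" "Suc m"] by simp
  ultimately have "(\<Prod>i = j + 1..m. 2 ^ i - 1 :: real) = (\<Prod>i = k + 1..Suc m. 2 ^ i - 1) * ((2 ^ k - 1) / (2 ^ Suc m - 1))"
    by (metis (no_types, lifting) mult.commute nonzero_eq_divide_eq times_divide_eq_right)
  then have "num_formula m (k - 1) = num_formula (Suc m) k * ((2 ^ k - 1) / (2 ^ Suc m - 1))"
    by (simp add: num_formula_def Suc)
  moreover have "2 * 2 ^ m / 2 ^ k * (2 ^ k - 1) = (2 ^ Suc m - 2 ^ (Suc m - k) :: real)"
    by (simp add: Suc m field_simps power_add)
  ultimately have "2 * 2 ^ m / 2 ^ k * num_formula m (k - 1) =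
      num_formula (Suc m) k * ((2 ^ Suc m - 2 ^ (Suc m - k)) / (2 ^ Suc m - 1))"
    by (simp only: mult.left_commute[of "2 * 2 ^ m / 2 ^ k"] times_divide_eq_right)
  then show ?thesis
    using Suc by simp
qed simp

text \<open>Induction on the matrix size: the pivot and nonpivot fractions add up to 1.\<close>

lemma num_ker_eq:
  assumes "finite I"
  shows "num_ker I k = (if k \<le> card I then num_formula (card I) k else 0)"
  using assms
proof (induction arbitrary: k)
  case empty
  have "ker {} (0 :: 'a \<Rightarrow> 'a \<Rightarrow> bit) = {0}"
    by (auto simp: ker_def)
  moreover have "Suc 0 = 2 ^ k \<longleftrightarrow> k = 0"
    using power_inject_exp[of "2::nat" 0 k] by auto
  ultimately have "{M \<in> Sym ({} :: 'a set). card (ker {} M) = 2 ^ k} = (if k = 0 then {0} else {})"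
    by (simp add: Collect_conv_if)
  then show ?case
    by (simp add: num_ker_def num_formula_def even_prod_def)
next
  case (insert a I)
  let ?m = "card I"
  show ?case
  proof (cases "k \<le> Suc ?m")
    case True
    have "num_ker (insert a I) k = num_formula (Suc ?m) k * ((2 ^ (Suc ?m - k) - 1) / (2 ^ Suc ?m - 1))
       + num_formula (Suc ?m) k * ((2 ^ Suc ?m - 2 ^ (Suc ?m - k)) / (2 ^ Suc ?m - 1))"
      unfolding num_ker_recurrence[OF insert(1,2)] insert.IH
        num_formula_pivot[OF True, symmetric] num_formula_nonpivot[OF True, symmetric]
      using True by auto
    also have "\<dots> = num_formula (Suc ?m) k * ((2 ^ Suc ?m - 1) / (2 ^ Suc ?m - 1))"
      by (simp only: distrib_left[symmetric] add_divide_distrib[symmetric]) simp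
    also have "2 ^ Suc ?m - (1::real) \<noteq> 0"
      using one_less_power[of "2::real" "Suc ?m"] by simp
    then have "(2 ^ Suc ?m - 1) / (2 ^ Suc ?m - 1) = (1::real)"
      by simp
    finally show ?thesis
      using True insert by simp
  next
    case False
    then show ?thesis
      unfolding num_ker_recurrence[OF insert(1,2)] insert.IH using insert by auto
  qed
qed

lemma num_pivot_eq:
  assumes "finite I" "a \<in> I" "k \<le> card I"
  shows "real (card {M \<in> Sym I. card (ker I M) = 2 ^ k \<and> (\<forall>z\<in>ker I M. z a = 0)}) =
    num_formula (card I) k * ((2 ^ (card I - k) - 1) / (2 ^ card I - 1))"
proof -
  obtain J where J: "I = insert a J" "a \<notin> J"
    using assms(2) by (meson mk_disjoint_insert)
  then have fin: "finite J" and card: "card I = Suc (card J)"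
    using assms by auto
  then show ?thesis
    using assms(3) unfolding J(1) num_pivot_recurrence[OF fin J(2)] num_ker_eq[OF fin]
    using num_formula_pivot[of k "card J"] J by simp
qed

section \<open>From a unit vector to the all-ones vector\<close>

text \<open>The matrix \<open>P M P\<^sup>T\<close>, where \<open>P\<close> adds entry \<open>a\<close> of a vector to every other entry; \<open>P\<close> is
  an involution mapping the all-ones vector to the unit vector at \<open>a\<close>, and \<open>vec_shift\<close> is \<open>P\<^sup>T\<close>.\<close>

definition row_shift :: "'a \<Rightarrow> 'a set \<Rightarrow> ('a \<Rightarrow> 'a \<Rightarrow> bit) \<Rightarrow> 'a \<Rightarrow> 'a \<Rightarrow> bit" where
  "row_shift a I M = (\<lambda>i j. if i \<notin> insert a I \<or> j \<notin> insert a I then 0 else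
      M i j + (if j = a then 0 else M i a) + (if i = a then 0 else M a j) + (if i = a \<or> j = a then 0 else M a a))"

definition vec_shift :: "'a \<Rightarrow> 'a set \<Rightarrow> ('a \<Rightarrow> bit) \<Rightarrow> 'a \<Rightarrow> bit" where
  "vec_shift a I x = x(a := x a + (\<Sum>i\<in>I. x i))"

lemma row_shift_in_Sym: "M \<in> Sym (insert a I) \<Longrightarrow> row_shift a I M \<in> Sym (insert a I)"
  by (auto simp: Sym_def row_shift_def ac_simps)

lemma row_shift_row_shift: "M \<in> Sym (insert a I) \<Longrightarrow> row_shift a I (row_shift a I M) = M"
  using Sym_outside[of M "insert a I"] by (auto simp: row_shift_def fun_eq_iff ac_simps)

lemma app_vec_shift:
  assumes "finite I" "a \<notin> I"
  shows "app (insert a I) M (vec_shift a I x) i = M i a * (x a + (\<Sum>j\<in>I. x j)) + (\<Sum>j\<in>I. M i j * x j)"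
proof -
  have "(\<Sum>j\<in>I. M i j * vec_shift a I x j) = (\<Sum>j\<in>I. M i j * x j)"
    by (rule sum.cong) (use assms in \<open>auto simp: vec_shift_def\<close>)
  then show ?thesis
    using assms by (simp add: app_def) (simp add: vec_shift_def)
qed

text \<open>The identity \<open>(P M P\<^sup>T) x = P (M (P\<^sup>T x))\<close>, read off at
  coordinate \<open>i\<close>.\<close>

lemma app_row_shift:
  assumes "finite I" "a \<notin> I" "i \<in> insert a I"
  shows "app (insert a I) (row_shift a I M) x i =
    app (insert a I) M (vec_shift a I x) i + (if i = a then 0 else app (insert a I) M (vec_shift a I x) a)"
proof (cases "i = a")
  have expand: "app (insert a I) (row_shift a I M) x i =
      row_shift a I M i a * x a + (\<Sum>j\<in>I. row_shift a I M i j * x j)"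
    using assms by (simp add: app_def)
  note rules = expand app_vec_shift[OF assms(1,2)]
  case True
  have "(\<Sum>j\<in>I. row_shift a I M a j * x j) = (\<Sum>j\<in>I. M a j * x j + M a a * x j)"
    by (rule sum.cong) (use assms in \<open>auto simp: row_shift_def distrib_right\<close>)
  moreover have "row_shift a I M a a = M a a"
    by (simp add: row_shift_def)
  ultimately show ?thesis
    unfolding rules by (simp add: True sum.distrib sum_distrib_left sum_distrib_right distrib_left ac_simps)
next
  have expand: "app (insert a I) (row_shift a I M) x i =
      row_shift a I M i a * x a + (\<Sum>j\<in>I. row_shift a I M i j * x j)"
    using assms by (simp add: app_def)
  note rules = expand app_vec_shift[OF assms(1,2)]
  case False
  have "(\<Sum>j\<in>I. row_shift a I M i j * x j) = (\<Sum>j\<in>I. M i j * x j + M i a * x j + M a j * x j + M a a * x j)"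
    by (rule sum.cong) (use assms False in \<open>auto simp: row_shift_def distrib_right\<close>)
  moreover have "row_shift a I M i a = M i a + M a a"
    using False assms by (simp add: row_shift_def)
  ultimately show ?thesis
    unfolding rules by (simp add: False sum.distrib sum_distrib_left sum_distrib_right distrib_left distrib_right ac_simps)
qed

lemma vec_shift_vec_shift: "a \<notin> I \<Longrightarrow> vec_shift a I (vec_shift a I x) = x"
proof -
  assume "a \<notin> I"
  then have "(\<Sum>i\<in>I. vec_shift a I x i) = (\<Sum>i\<in>I. x i)"
    by (intro sum.cong) (auto simp: vec_shift_def)
  then show ?thesis
    unfolding vec_shift_def[of a I "vec_shift a I x"] by (simp add: vec_shift_def fun_eq_iff add.assoc)
qed

text \<open>Pairing with the all-ones vector turns into pairing with the unit vector at
  \<open>a\<close> when \<open>P\<^sup>T\<close> is moved across the dot product.\<close>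

lemma sum_vec_shift: "finite I \<Longrightarrow> a \<notin> I \<Longrightarrow> (\<Sum>i\<in>insert a I. vec_shift a I x i) = x a"
proof -
  assume "finite I" "a \<notin> I"
  moreover from this have "(\<Sum>i\<in>I. vec_shift a I x i) = (\<Sum>i\<in>I. x i)"
    by (intro sum.cong) (auto simp: vec_shift_def)
  ultimately show ?thesis
    by (simp add: add.assoc) (simp add: vec_shift_def add.assoc)
qed

lemma vec_shift_in_ker_iff:
  assumes fin: "finite I" "a \<notin> I" and M: "M \<in> Sym (insert a I)"
  shows "vec_shift a I x \<in> ker (insert a I) M \<longleftrightarrow> x \<in> ker (insert a I) (row_shift a I M)"
proof -
  let ?J = "insert a I"
  have "vec_shift a I x \<in> vecs ?J \<longleftrightarrow> x \<in> vecs ?J"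
    by (auto simp: vecs_def vec_shift_def)
  moreover have zero: "app ?J N y = 0 \<longleftrightarrow> (\<forall>i\<in>?J. app ?J N y i = 0)" if "N \<in> Sym ?J" for N y
    using app_in_vecs[OF that, of y] by (auto simp: vecs_def fun_eq_iff)
  have "app ?J (row_shift a I M) x = 0 \<longleftrightarrow> app ?J M (vec_shift a I x) = 0"
    unfolding zero[OF M] zero[OF row_shift_in_Sym[OF M]]
    using app_row_shift[OF fin, of _ M x] by auto
  ultimately show ?thesis
    by (simp add: ker_def)
qed

lemma bij_betw_vec_shift_ker:
  assumes "finite I" "a \<notin> I" "M \<in> Sym (insert a I)"
  shows "bij_betw (vec_shift a I) (ker (insert a I) (row_shift a I M)) (ker (insert a I) M)"
  by (rule bij_betw_byWitness[of _ "vec_shift a I"])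
    (use assms in \<open>auto simp: vec_shift_vec_shift vec_shift_in_ker_iff simp flip: vec_shift_in_ker_iff\<close>)

definition ones :: "'a set \<Rightarrow> 'a \<Rightarrow> bit" where
  "ones I = (\<lambda>i. of_bool (i \<in> I))"

text \<open>Membership in the image is orthogonality to the kernel, and \<open>vec_shift\<close>
  carries the kernel of the shifted matrix onto that of \<open>M\<close>, turning coordinate sums
  into entries at \<open>a\<close>.\<close>

lemma ones_in_img_iff:
  assumes fin: "finite I" "a \<notin> I" and M: "M \<in> Sym (insert a I)"
  shows "ones (insert a I) \<in> img (insert a I) M \<longleftrightarrow> (\<forall>z\<in>ker (insert a I) (row_shift a I M). z a = 0)"
proof -
  let ?J = "insert a I"
  have "dot ?J (ones ?J) x = (\<Sum>i\<in>?J. x i)" for x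
    unfolding dot_def by (rule sum.cong) (auto simp: ones_def)
  then have "ones ?J \<in> img ?J M \<longleftrightarrow> (\<forall>x\<in>ker ?J M. (\<Sum>i\<in>?J. x i) = 0)"
    using fin M by (simp only: img_eq_annihilator finite_insert) (simp add: vecs_def ones_def)
  also have "ker ?J M = vec_shift a I ` ker ?J (row_shift a I M)"
    using bij_betw_vec_shift_ker[OF fin M] by (simp add: bij_betw_def)
  finally show ?thesis
    by (simp only: Ball_image_comp o_def sum_vec_shift[OF fin])
qed

text \<open>\<open>row_shift\<close> is an involution on symmetric matrices that preserves kernel
  size and exchanges the all-ones condition for the pivot condition. Any element of \<open>I\<close>
  can serve as the pivot.\<close>

lemma num_ones_eq:
  assumes fin: "finite I" and "I \<noteq> {}" "k \<le> card I"
  shows "real (card {M \<in> Sym I. card (ker I M) = 2 ^ k \<and> ones I \<in> img I M}) =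
    num_formula (card I) k * ((2 ^ (card I - k) - 1) / (2 ^ card I - 1))"
proof -
  obtain a J where J: "I = insert a J" "a \<notin> J"
    using assms(2) by (meson all_not_in_conv mk_disjoint_insert)
  have finJ: "finite J"
    using fin J by simp
  have card_ker: "card (ker I (row_shift a J M)) = card (ker I M)" if "M \<in> Sym I" for M
    using bij_betw_same_card[OF bij_betw_vec_shift_ker[OF finJ J(2)]] that J(1) by simp
  have "bij_betw (row_shift a J) {M \<in> Sym I. card (ker I M) = 2 ^ k \<and> ones I \<in> img I M}
      {M \<in> Sym I. card (ker I M) = 2 ^ k \<and> (\<forall>z\<in>ker I M. z a = 0)}"
    by (rule bij_betw_byWitness[of _ "row_shift a J"])
      (use finJ J(2) card_ker in \<open>auto simp: J(1) row_shift_row_shift row_shift_in_Sym ones_in_img_iff\<close>)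
  then have "card {M \<in> Sym I. card (ker I M) = 2 ^ k \<and> ones I \<in> img I M} =
      card {M \<in> Sym I. card (ker I M) = 2 ^ k \<and> (\<forall>z\<in>ker I M. z a = 0)}"
    by (rule bij_betw_same_card)
  then show ?thesis
    using num_pivot_eq[of I a k] assms J by simp
qed

section \<open>The random graph\<close>

lemma of_nat_bit_eq: "of_nat k = (of_bool (odd k) :: bit)"
  by (induction k) auto

lemma sum_of_bool_bit: "finite A \<Longrightarrow> (\<Sum>x\<in>A. of_bool (P x)) = (of_bool (odd (card {x \<in> A. P x})) :: bit)"
proof -
  assume "finite A"
  then have "(\<Sum>x\<in>A. of_bool (P x)) = (of_nat (card {x \<in> A. P x}) :: bit)"
    by (simp add: Int_def)
  then show ?thesis
    by (simp only: of_nat_bit_eq)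
qed

lemma vecs_support: "x \<in> vecs I \<Longrightarrow> {i. x i = 1} \<subseteq> I"
  unfolding vecs_def by (metis (mono_tags, lifting) mem_Collect_eq subsetI zero_neq_one)

text \<open>The handshake argument: terms off the diagonal occur twice and cancel.\<close>

lemma sum_sum_symmetric_bit:
  fixes h :: "'a \<Rightarrow> 'a \<Rightarrow> bit"
  assumes "finite S" and sym: "\<And>i j. h i j = h j i" and diag: "\<And>i. h i i = 0"
  shows "(\<Sum>i\<in>S. \<Sum>j\<in>S. h i j) = 0"
  using assms(1)
proof induction
  case (insert a S)
  have "(\<Sum>i\<in>S. h i a) = (\<Sum>i\<in>S. h a i)"
    by (rule sum.cong) (auto simp: sym[of a])
  then show ?case
    using insert by (simp add: diag sum.distrib)
qed simp

section \<open>Degrees inside the parts and the reduced Laplacian\<close>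

definition presence_graph :: "nat \<Rightarrow> (nat set \<Rightarrow> bool) \<Rightarrow> nat graph" where
  "presence_graph n p = ({1..n}, {e \<in> possible_edges {1..n}. p e})"

definition adj :: "(nat set \<Rightarrow> bool) \<Rightarrow> nat \<Rightarrow> nat \<Rightarrow> bit" where
  "adj p u v = of_bool (u \<noteq> v \<and> p {u, v})"

text \<open>The diagonal sums run over all of \<open>{1..n}\<close>, including the deleted vertex
  \<open>n\<close>; this keeps the edges at \<open>n\<close> recoverable.\<close>

definition lap :: "nat \<Rightarrow> (nat set \<Rightarrow> bool) \<Rightarrow> nat \<Rightarrow> nat \<Rightarrow> bit" where
  "lap n p i j = (if i \<notin> {1..<n} \<or> j \<notin> {1..<n} then 0
     else if i = j then \<Sum>u\<in>{1..n}. adj p i u else adj p i j)"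

lemma adj_commute: "adj p u v = adj p v u"
  by (auto simp: adj_def insert_commute)

lemma adj_self [simp]: "adj p u u = 0"
  by (simp add: adj_def)

lemma lap_in_Sym: "lap n p \<in> Sym {1..<n}"
  by (auto simp: Sym_def lap_def adj_commute)

lemma odd_degree_induced:
  assumes "S \<subseteq> {1..n}" "v \<in> S"
  shows "odd (degree (induced (presence_graph n p) S) v) \<longleftrightarrow> (\<Sum>u\<in>S. adj p v u) = 1"
proof -
  have "bij_betw (\<lambda>u. {v, u}) {u \<in> S. v \<noteq> u \<and> p {v, u}}
      {e \<in> edges (induced (presence_graph n p) S). v \<in> e}"
  proof (rule bij_betw_imageI)
    show "inj_on (\<lambda>u. {v, u}) {u \<in> S. v \<noteq> u \<and> p {v, u}}"
      by (auto simp: inj_on_def doubleton_eq_iff)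
    show "(\<lambda>u. {v, u}) ` {u \<in> S. v \<noteq> u \<and> p {v, u}} = {e \<in> edges (induced (presence_graph n p) S). v \<in> e}"
    proof (intro equalityI subsetI)
      fix e assume "e \<in> {e \<in> edges (induced (presence_graph n p) S). v \<in> e}"
      then have e: "e \<subseteq> S" "card e = 2" "p e" "v \<in> e"
        by (auto simp: edges_def induced_def presence_graph_def possible_edges_def)
      then obtain u where "e = {v, u}" "u \<noteq> v"
        by (auto simp: card_2_iff)
      then show "e \<in> (\<lambda>u. {v, u}) ` {u \<in> S. v \<noteq> u \<and> p {v, u}}"
        using e by auto
    qed (use assms in \<open>auto simp: edges_def induced_def presence_graph_def possible_edges_def\<close>)
  qed
  then have "degree (induced (presence_graph n p) S) v = card {u \<in> S. v \<noteq> u \<and> p {v, u}}"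
    unfolding degree_def by (rule bij_betw_same_card[symmetric])
  moreover have "finite S"
    using assms finite_subset by blast
  ultimately show ?thesis
    by (simp only: adj_def sum_of_bool_bit of_bool_eq_1_iff)
qed

text \<open>The degree, modulo 2, of \<open>i\<close> inside its own part: the factor is \<open>1\<close> iff \<open>x u = x i\<close>.\<close>

definition own_degree :: "nat \<Rightarrow> (nat set \<Rightarrow> bool) \<Rightarrow> (nat \<Rightarrow> bit) \<Rightarrow> nat \<Rightarrow> bit" where
  "own_degree n p x i = (\<Sum>u\<in>{1..n}. (1 + x i + x u) * adj p i u)"

lemma own_degree_eq:
  assumes "S \<subseteq> {1..n}" "i \<in> S" "\<And>u. u \<in> {1..n} \<Longrightarrow> u \<in> S \<longleftrightarrow> x u = x i"
  shows "own_degree n p x i = (\<Sum>u\<in>S. adj p i u)"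
proof -
  have "own_degree n p x i = (\<Sum>u\<in>{1..n}. if u \<in> S then adj p i u else 0)"
    unfolding own_degree_def
  proof (rule sum.cong[OF refl])
    fix u assume "u \<in> {1..n}"
    then show "(1 + x i + x u) * adj p i u = (if u \<in> S then adj p i u else 0)"
      using assms(3)[of u] by (cases "x i"; cases "x u") auto
  qed
  also have "\<dots> = (\<Sum>u\<in>S. adj p i u)"
    using assms(1) by (simp add: sum.If_cases Int_absorb1)
  finally show ?thesis .
qed

lemma all_degrees_odd_iff_own_degree:
  assumes "x \<in> vecs {1..<n}"
  shows "all_degrees_odd (induced (presence_graph n p) {i. x i = 1}) \<and>
      all_degrees_odd (induced (presence_graph n p) ({1..n} - {i. x i = 1})) \<longleftrightarrow>
    (\<forall>i\<in>{1..n}. own_degree n p x i = 1)"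
proof -
  let ?A = "{i. x i = 1}"
  have A: "?A \<subseteq> {1..n}"
    using vecs_support[OF assms] by auto
  have "all_degrees_odd (induced (presence_graph n p) ?A) \<longleftrightarrow> (\<forall>i\<in>?A. own_degree n p x i = 1)"
    unfolding all_degrees_odd_def
    by (rule ball_cong) (use A own_degree_eq[OF A] odd_degree_induced[OF A] in \<open>auto simp: verts_def induced_def\<close>)
  moreover have B: "{1..n} - ?A \<subseteq> {1..n}"
    by auto
  have "all_degrees_odd (induced (presence_graph n p) ({1..n} - ?A)) \<longleftrightarrow>
      (\<forall>i\<in>{1..n} - ?A. own_degree n p x i = 1)"
    unfolding all_degrees_odd_def
    by (rule ball_cong) (use own_degree_eq[OF B] odd_degree_induced[OF B] in \<open>auto simp: verts_def induced_def\<close>)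
  ultimately show ?thesis
    using A by blast
qed

lemma sum_own_degree: "(\<Sum>i\<in>{1..n}. own_degree n p x i) = 0"
  unfolding own_degree_def
  by (rule sum_sum_symmetric_bit) (auto simp: adj_commute ac_simps)

text \<open>All own degrees sum to 0, and the \<open>n - 1\<close> known ones, an odd number of
  ones, sum to 1.\<close>

lemma own_degree_last:
  assumes "even n" "n > 0" "\<forall>i\<in>{1..<n}. own_degree n p x i = 1"
  shows "own_degree n p x n = 1"
proof -
  have "{1..n} = insert n {1..<n}"
    using assms(2) by auto
  then have "own_degree n p x n + (\<Sum>i\<in>{1..<n}. own_degree n p x i) = 0"
    using sum_own_degree[of n p x] by simp
  moreover have "(\<Sum>i\<in>{1..<n}. own_degree n p x i) = 1"
    using assms by (simp add: of_nat_bit_eq)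
  ultimately show ?thesis
    by (simp add: bit_add_eq_0_iff)
qed

text \<open>Expanding the factor \<open>1 + x i + x u\<close> gives the degree of \<open>i\<close>,
  the diagonal term of the product, and its off-diagonal part. The summand at \<open>n\<close>
  disappears from the last because \<open>x n = 0\<close>.\<close>

lemma own_degree_eq_app_lap:
  assumes "x \<in> vecs {1..<n}" "i \<in> {1..<n}"
  shows "own_degree n p x i = lap n p i i + app {1..<n} (lap n p) x i"
proof -
  have V: "{1..n} = insert n {1..<n}"
    using assms(2) by auto
  have "x n = 0"
    using assms(1) by (simp add: vecs_def)
  have "app {1..<n} (lap n p) x i =
      (\<Sum>j\<in>{1..<n}. (if j = i then (\<Sum>u\<in>{1..n}. adj p i u) * x i else 0) + x j * adj p i j)"
    unfolding app_def by (rule sum.cong) (use assms in \<open>auto simp: lap_def\<close>)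
  also have "\<dots> = (\<Sum>u\<in>{1..n}. adj p i u) * x i + (\<Sum>j\<in>{1..n}. x j * adj p i j)"
    using assms(2) \<open>x n = 0\<close> unfolding sum.distrib V by simp
  finally show ?thesis
    using assms(2) by (simp add: own_degree_def lap_def distrib_left distrib_right sum.distrib sum_distrib_left ac_simps)
qed

lemma all_degrees_odd_iff_solution:
  assumes "even n" "n > 0" "x \<in> vecs {1..<n}"
  shows "all_degrees_odd (induced (presence_graph n p) {i. x i = 1}) \<and>
      all_degrees_odd (induced (presence_graph n p) ({1..n} - {i. x i = 1})) \<longleftrightarrow>
    app {1..<n} (lap n p) x = (\<lambda>i. lap n p i i) + ones {1..<n}"
proof -
  have "{1..n} = insert n {1..<n}"
    using assms(2) by auto
  then have "(\<forall>i\<in>{1..n}. own_degree n p x i = 1) \<longleftrightarrow> (\<forall>i\<in>{1..<n}. own_degree n p x i = 1)"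
    using own_degree_last[OF assms(1,2)] by auto
  also have "\<dots> \<longleftrightarrow> (\<forall>i\<in>{1..<n}. app {1..<n} (lap n p) x i = lap n p i i + 1)"
  proof (rule ball_cong[OF refl])
    fix i assume i: "i \<in> {1..<n}"
    show "own_degree n p x i = 1 \<longleftrightarrow> app {1..<n} (lap n p) x i = lap n p i i + 1"
      unfolding own_degree_eq_app_lap[OF assms(3) i]
      by (cases "lap n p i i"; cases "app {1..<n} (lap n p) x i") simp_all
  qed
  also have "\<dots> \<longleftrightarrow> app {1..<n} (lap n p) x = (\<lambda>i. lap n p i i) + ones {1..<n}"
  proof -
    have outside: "app {1..<n} (lap n p) x i = 0" "lap n p i i = 0" if "i \<notin> {1..<n}" for i
      using app_in_vecs[OF lap_in_Sym, of n p x] that by (auto simp: vecs_def lap_def)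
    have "(app {1..<n} (lap n p) x i = lap n p i i + ones {1..<n} i) \<longleftrightarrow>
        (i \<in> {1..<n} \<longrightarrow> app {1..<n} (lap n p) x i = lap n p i i + 1)" for i
    proof (cases "i \<in> {1..<n}")
      case False
      then show ?thesis
        unfolding outside[OF False] by (simp add: ones_def)
    qed (simp add: ones_def)
    then show ?thesis
      unfolding fun_eq_iff plus_fun_apply by blast
  qed
  finally show ?thesis
    unfolding all_degrees_odd_iff_own_degree[OF assms(3)] .
qed

lemma num_odd_partitions_eq_card_solutions:
  assumes "even n" "n > 0"
  shows "num_odd_partitions (presence_graph n p) =
    card {x \<in> vecs {1..<n}. app {1..<n} (lap n p) x = (\<lambda>i. lap n p i i) + ones {1..<n}}"
proof -
  let ?G = "presence_graph n p" and ?part = "\<lambda>x. {{i. x i = 1}, {1..n} - {i. x i = (1::bit)}}"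
  let ?S = "{x \<in> vecs {1..<n}. app {1..<n} (lap n p) x = (\<lambda>i. lap n p i i) + ones {1..<n}}"
  have n: "n \<in> {1..n}"
    using assms by simp
  have verts: "verts ?G = {1..n}"
    by (simp add: verts_def presence_graph_def)
  have notin: "n \<notin> {i. x i = 1}" and sub: "{i. x i = 1} \<subseteq> {1..n}" if "x \<in> vecs {1..<n}" for x
    using vecs_support[OF that] by auto
  have "bij_betw ?part ?S (odd_partitions ?G)"
  proof (rule bij_betw_imageI)
    show "inj_on ?part ?S"
    proof (rule inj_onI)
      fix x y assume "x \<in> ?S" "y \<in> ?S" and eq: "?part x = ?part y"
      \<comment> \<open>A crosswise match of the two pairs is impossible, as \<open>n\<close> lies
        only in the second set of each.\<close>
      then have "{i. x i = 1} = {i. y i = 1}"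
        using notin[of x] notin[of y] n by (auto simp only: doubleton_eq_iff mem_Collect_eq Diff_iff)
      then have "x i = 1 \<longleftrightarrow> y i = 1" for i
        by auto
      then show "x = y"
        by (metis bit_not_one_iff ext)
    qed
    show "?part ` ?S = odd_partitions ?G"
    proof (intro equalityI subsetI)
      fix P assume "P \<in> ?part ` ?S"
      then obtain x where x: "x \<in> ?S" "P = ?part x"
        by auto
      then show "P \<in> odd_partitions ?G"
        using all_degrees_odd_iff_solution[OF assms, of x p] sub[of x]
        unfolding odd_partitions_def verts by blast
    next
      fix P assume "P \<in> odd_partitions ?G"
      then obtain A B where P: "P = {A, B}" "A \<union> B = {1..n}" "A \<inter> B = {}"
        "all_degrees_odd (induced ?G A)" "all_degrees_odd (induced ?G B)"
        unfolding odd_partitions_def verts by blast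
      \<comment> \<open>The pair is unordered, so the names can be swapped to make \<open>A\<close>
        the part avoiding \<open>n\<close>.\<close>
      then obtain A B where P: "P = {A, B}" "A \<union> B = {1..n}" "A \<inter> B = {}" "n \<notin> A"
        "all_degrees_odd (induced ?G A)" "all_degrees_odd (induced ?G B)"
        using insert_commute Un_commute Int_commute n by (metis Int_iff empty_iff)
      define x :: "nat \<Rightarrow> bit" where "x = (\<lambda>i. of_bool (i \<in> A))"
      have "i \<in> {1..<n}" if "i \<in> A" for i
      proof -
        have "i \<in> {1..n}" "i \<noteq> n"
          using that P by blast+
        then show ?thesis
          by simp
      qed
      then have "x \<in> vecs {1..<n}"
        by (auto simp: vecs_def x_def)
      moreover have "{i. x i = 1} = A" "{1..n} - {i. x i = 1} = B"
        using P by (auto simp: x_def)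
      ultimately show "P \<in> ?part ` ?S"
        using P all_degrees_odd_iff_solution[OF assms, of x p] by (intro image_eqI[of _ _ x]) auto
    qed
  qed
  then show ?thesis
    unfolding num_odd_partitions_def by (simp only: bij_betw_same_card)
qed

section \<open>Uniformity of the reduced Laplacian\<close>

abbreviation presences :: "nat \<Rightarrow> (nat set \<Rightarrow> bool) set" where
  "presences n \<equiv> PiE_dflt (possible_edges {1..n}) False (\<lambda>_. UNIV)"

lemma finite_possible_edges [simp]: "finite V \<Longrightarrow> finite (possible_edges V)"
  by (simp add: possible_edges_def)

lemma card_presences: "card (presences n) = 2 ^ (n choose 2)"
  using n_subsets[of "{1..n}" 2] by (simp add: card_PiE_dflt possible_edges_def)

text \<open>Off-diagonal entries reveal the edges avoiding \<open>n\<close>; each diagonal entry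
  then reveals the edge to \<open>n\<close>. Surjectivity follows because both sets have
  \<open>2 ^ (n choose 2)\<close> elements.\<close>

lemma bij_betw_lap:
  assumes "n > 0"
  shows "bij_betw (lap n) (presences n) (Sym {1..<n})"
proof -
  have inj: "inj_on (lap n) (presences n)"
  proof (rule inj_onI)
    fix p q assume p: "p \<in> presences n" and q: "q \<in> presences n" and eq: "lap n p = lap n q"
    have V: "{1..n} = insert n {1..<n}"
      using assms by auto
    have inner: "adj p u v = adj q u v" if "u \<in> {1..<n}" "v \<in> {1..<n}" for u v
      using fun_cong[OF fun_cong[OF eq, of u], of v] that by (cases "u = v") (auto simp: lap_def)
    have last: "adj p u n = adj q u n" if "u \<in> {1..<n}" for u
    proof -
      have "lap n p u u = lap n q u u"
        using eq by simp
      then have "adj p u n + (\<Sum>v\<in>{1..<n}. adj p u v) = adj q u n + (\<Sum>v\<in>{1..<n}. adj q u v)"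
        using that unfolding lap_def V by simp
      moreover have "(\<Sum>v\<in>{1..<n}. adj p u v) = (\<Sum>v\<in>{1..<n}. adj q u v)"
        using inner that by (intro sum.cong) auto
      ultimately show ?thesis
        by simp
    qed
    have all: "adj p u v = adj q u v" if "u \<in> {1..n}" "v \<in> {1..n}" for u v
      using that inner last adj_commute[of _ n v] unfolding V by auto
    show "p = q"
    proof
      fix e
      show "p e = q e"
      proof (cases "e \<in> possible_edges {1..n}")
        case True
        then obtain u v where "e = {u, v}" "u \<noteq> v" "u \<in> {1..n}" "v \<in> {1..n}"
          by (auto simp: possible_edges_def card_2_iff)
        then show ?thesis
          using all[of u v] by (simp add: adj_def of_bool_eq_iff)
      next
        \<comment> \<open>Off the possible edges both indicators take the default value
          \<open>False\<close>.\<close>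
        case False
        then show ?thesis
          using p q by (simp add: PiE_dflt_def)
      qed
    qed
  qed
  have "lap n ` presences n = Sym {1..<n}"
  proof (rule card_subset_eq)
    show "card (lap n ` presences n) = card (Sym {1..<n})"
      unfolding card_image[OF inj] card_presences using assms by (simp add: card_Sym)
    show "lap n ` presences n \<subseteq> Sym {1..<n}"
      using lap_in_Sym by blast
  qed simp
  with inj show ?thesis
    by (simp only: bij_betw_def)
qed

text \<open>Independent fair coins give a uniform element of \<open>presences n\<close>, and the
  bijection \<open>lap n\<close> turns the probability into a count of matrices.\<close>

lemma prob_num_odd_partitions:
  assumes "even n" "n > 0"
  shows "measure_pmf.prob (binomial_random_graph n (1/2)) {G. num_odd_partitions G = z} =
    real (card {M \<in> Sym {1..<n}. (if ones {1..<n} \<in> img {1..<n} M then card (ker {1..<n} M) else 0) = z})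
      / 2 ^ (n choose 2)"
proof -
  let ?f = "\<lambda>M. if ones {1..<n} \<in> img {1..<n} M then card (ker {1..<n} M) else 0"
  have num: "num_odd_partitions (presence_graph n p) = ?f (lap n p)" for p
    using num_odd_partitions_eq_card_solutions[OF assms] card_solutions_diag_add[OF _ lap_in_Sym] by simp
  have "binomial_random_graph n (1/2) = map_pmf (presence_graph n) (pmf_of_set (presences n))"
    unfolding binomial_random_graph_def bernoulli_pmf_half_conv_pmf_of_set presence_graph_def
    by (subst Pi_pmf_of_set) auto
  then have "measure_pmf.prob (binomial_random_graph n (1/2)) {G. num_odd_partitions G = z} =
      real (card (presences n \<inter> {p. ?f (lap n p) = z})) / card (presences n)"
    by (simp only: measure_map_pmf) (subst measure_pmf_of_set, auto simp: num vimage_def)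
  also have "bij_betw (lap n) (presences n \<inter> {p. ?f (lap n p) = z}) {M \<in> Sym {1..<n}. ?f M = z}"
    using bij_betw_lap[OF assms(2)] by (rule bij_betw_subset) (use bij_betw_lap[OF assms(2)] in \<open>auto simp: bij_betw_def\<close>)
  then have "card (presences n \<inter> {p. ?f (lap n p) = z}) = card {M \<in> Sym {1..<n}. ?f M = z}"
    by (rule bij_betw_same_card)
  finally show ?thesis
    by (simp only: card_presences of_nat_power of_nat_numeral)
qed

theorem theorem5p5:
  fixes n :: nat
  assumes "even n" and "n > 0"
  shows "(\<forall>k::nat. k \<le> n - 1 \<longrightarrow>
            measure_pmf.prob (binomial_random_graph n (1/2)) {G. num_odd_partitions G = 2 ^ k} =
              (2 ^ (n - k - 1) - 1) / (2 ^ (n choose 2) * (2 ^ (n - 1) - 1)) *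
              (\<Prod>i = 1..(n - 1 - k) div 2. inverse (1 - 1 / 2 ^ (2 * i))) *
              (\<Prod>i = k + 1..n - 1. 2 ^ i - 1)) \<and>
         (\<forall>x::nat. x \<noteq> 0 \<and> (\<forall>k::nat. k \<le> n - 1 \<longrightarrow> x \<noteq> 2 ^ k) \<longrightarrow>
            measure_pmf.prob (binomial_random_graph n (1/2)) {G. num_odd_partitions G = x} = 0)"
proof (intro conjI allI impI)
  let ?I = "{1..<n}"
  fix k assume k: "k \<le> n - 1"
  \<comment> \<open>A positive even \<open>n\<close> is at least 2, so an index for the pivot
    exists.\<close>
  have "?I \<noteq> {}"
    using assms by (auto elim!: evenE)
  have "{M \<in> Sym ?I. (if ones ?I \<in> img ?I M then card (ker ?I M) else 0) = 2 ^ k} =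
      {M \<in> Sym ?I. card (ker ?I M) = 2 ^ k \<and> ones ?I \<in> img ?I M}"
    by auto
  then have "measure_pmf.prob (binomial_random_graph n (1/2)) {G. num_odd_partitions G = 2 ^ k} =
      num_formula (n - 1) k * ((2 ^ (n - 1 - k) - 1) / (2 ^ (n - 1) - 1)) / 2 ^ (n choose 2)"
    using num_ones_eq[of ?I k] \<open>?I \<noteq> {}\<close> k by (simp add: prob_num_odd_partitions[OF assms])
  also have "\<dots> = (2 ^ (n - k - 1) - 1) / (2 ^ (n choose 2) * (2 ^ (n - 1) - 1)) *
              (\<Prod>i = 1..(n - 1 - k) div 2. inverse (1 - 1 / 2 ^ (2 * i))) *
              (\<Prod>i = k + 1..n - 1. 2 ^ i - 1)"
    by (simp add: num_formula_def even_prod_def diff_commute mult.commute)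
  finally show "measure_pmf.prob (binomial_random_graph n (1/2)) {G. num_odd_partitions G = 2 ^ k} =
              (2 ^ (n - k - 1) - 1) / (2 ^ (n choose 2) * (2 ^ (n - 1) - 1)) *
              (\<Prod>i = 1..(n - 1 - k) div 2. inverse (1 - 1 / 2 ^ (2 * i))) *
              (\<Prod>i = k + 1..n - 1. 2 ^ i - 1)" .
next
  let ?I = "{1..<n}"
  fix x :: nat assume x: "x \<noteq> 0 \<and> (\<forall>k. k \<le> n - 1 \<longrightarrow> x \<noteq> 2 ^ k)"
  have "card (ker ?I M) \<noteq> x" for M
    using card_ker_power2[of ?I M] x by auto
  then have "{M \<in> Sym ?I. (if ones ?I \<in> img ?I M then card (ker ?I M) else 0) = x} = {}"
    using x by auto
  then show "measure_pmf.prob (binomial_random_graph n (1/2)) {G. num_odd_partitions G = x} = 0"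
    unfolding prob_num_odd_partitions[OF assms] by simp
qed

end
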